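(* Let $\lambda\in\mathbb{R}$ be nonzero. For $m\in\mathbb{N}$, we have $$\sin_{\lambda}\big((2m+1)x:a\big)=(2m+1)\sin_{\lambda}\big(x:a\big) \prod_{k=1}^{m}\Bigg(1-\frac{\sin_{\lambda}^{2}(x:a)}{\sin^{2}\big(\frac{k \pi}{2m+1} \big)}\Bigg),$$ where $\sin_{\lambda}(x:a)$ is the degenerate sine function, $\sin_{\lambda}^{2}(x:a)=\big(\sin_{\lambda}(x:a)\big)^{2}$, and $\sin$ without subscript is the ordinary sine function.
   Context: For any nonzero $\lambda\in\mathbb{R}$, the degenerate exponentials are defined by $$e_{\lambda}^{x}(t)=\sum_{n=0}^{\infty}(x)_{n,\lambda}\frac{t^{n}}{n!},\qquad (x)_{0,\lambda}=1,\quad (x)_{n,\lambda}=x(x-\lambda)(x-2\lambda)\cdots\big(x-(n-1)\lambda\big)\ (n\ge 1).$$ With $i=\sqrt{-1}$, the degenerate sine function is $$\sin_{\lambda}(x:a)=\frac{e_{\lambda}^{xi}(a)-e_{\lambda}^{-xi}(a)}{2i}.$$ *)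

theory Defs
  imports "HOL-Analysis.Analysis"
begin

definition degenerate_falling :: "real \<Rightarrow> complex \<Rightarrow> nat \<Rightarrow> complex" where
  "degenerate_falling l x n = (\<Prod>k<n. x - of_nat k * of_real l)"

definition degenerate_exp_term :: "real \<Rightarrow> complex \<Rightarrow> complex \<Rightarrow> nat \<Rightarrow> complex" where
  "degenerate_exp_term l x t n = degenerate_falling l x n * t ^ n / fact n"

definition degenerate_exp :: "real \<Rightarrow> complex \<Rightarrow> complex \<Rightarrow> complex" where
  "degenerate_exp l x t = (\<Sum>n. degenerate_exp_term l x t n)"

definition degenerate_sin :: "real \<Rightarrow> complex \<Rightarrow> complex \<Rightarrow> complex" where
  "degenerate_sin l x a =
     (degenerate_exp l (x * \<i>) a - degenerate_exp l (- (x * \<i>)) a) / (2 * \<i>)"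

text \<open>The series of a degenerate exponential has radius of convergence \<open>1 / \<bar>l\<bar>\<close> in general, and
  \<^const>\<open>suminf\<close> carries no information on a divergent series. The following predicate says that
  both series entering \<^const>\<open>degenerate_sin\<close> converge, i.e. that \<open>degenerate_sin l x a\<close> is
  meaningful.\<close>

definition degenerate_sin_converges :: "real \<Rightarrow> complex \<Rightarrow> complex \<Rightarrow> bool" where
  "degenerate_sin_converges l x a \<longleftrightarrow>
     summable (degenerate_exp_term l (x * \<i>) a) \<and>
     summable (degenerate_exp_term l (- (x * \<i>)) a)"

lemma degenerate_exp_term_eq_gbinomial:
  assumes "l \<noteq> 0"
  shows "degenerate_exp_term l x t n = ((x / of_real l) gchoose n) * (of_real l * t) ^ n"
proof -
  have "degenerate_falling l x n = (\<Prod>k<n. of_real l * (x / of_real l - of_nat k))"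
    unfolding degenerate_falling_def using assms
    by (intro prod.cong) (auto simp: field_simps)
  also have "\<dots> = of_real l ^ n * (\<Prod>k<n. x / of_real l - of_nat k)"
    by (simp add: prod.distrib)
  finally show ?thesis
    by (simp add: degenerate_exp_term_def gbinomial_prod_rev atLeast0LessThan power_mult_distrib)
qed

lemma summable_degenerate_exp_term:
  assumes "l \<noteq> 0" "norm (of_real l * t) < 1"
  shows "summable (degenerate_exp_term l x t)"
proof -
  have "(\<lambda>n. ((x / of_real l) gchoose n) * (of_real l * t) ^ n) sums
          (1 + of_real l * t) powr (x / of_real l)"
    using assms(2) by (rule gen_binomial_complex)
  then have "summable (\<lambda>n. degenerate_exp_term l x t n)"
    unfolding degenerate_exp_term_eq_gbinomial[OF assms(1)] by (rule sums_summable)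
  then show ?thesis by simp
qed

lemma degenerate_sin_convergesI:
  assumes "l \<noteq> 0" "norm (of_real l * a) < 1"
  shows "degenerate_sin_converges l x a"
  using summable_degenerate_exp_term[OF assms] by (simp add: degenerate_sin_converges_def)

end

theory Submission
  imports Defs
begin

text \<open>For \<open>\<bar>\<lambda>a\<bar> < 1\<close> the binomial series gives \<open>sin\<^sub>\<lambda>(x:a) = sin (x/\<lambda> \<sqdot> Ln (1 + \<lambda>a))\<close>, so the claim
  is the product formula for \<open>sin ((2m+1)z)\<close>. The latter holds because \<open>sin ((2m+1)z) / sin z\<close> is a
  polynomial of degree at most \<open>m\<close> in \<open>sin\<^sup>2 z\<close> with value \<open>2m+1\<close> at \<open>0\<close> and the \<open>m\<close> distinct roots
  \<open>sin\<^sup>2 (k\<pi>/(2m+1))\<close>. On the circle \<open>\<bar>\<lambda>a\<bar> = 1\<close> the identity survives radial limits by Abel's limit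
  theorem. For \<open>\<bar>\<lambda>a\<bar> > 1\<close> both series converge only if \<open>\<plusminus> \<i>x/\<lambda>\<close> are natural numbers, that is, if
  \<open>x = 0\<close>.\<close>

section \<open>Abel's limit theorem via summation by parts\<close>

theorem Abel_limit:
  fixes c :: "nat \<Rightarrow> 'a::banach"
  assumes c: "summable c"
  shows "((\<lambda>r. \<Sum>n. r ^ n *\<^sub>R c n) \<longlongrightarrow> suminf c) (at_left 1)"
proof -
  \<comment> \<open>\<open>D n\<close> is the tail beyond index \<open>n\<close>. Writing terms as
    differences of tails reduces the claim to a power series whose coefficients tend to 0.\<close>
  define D where "D n = (\<Sum>k. c (k + Suc n))" for n
  have D_lim: "D \<longlonglongrightarrow> 0"
  proof -
    have "(\<lambda>n. suminf c - sum c {..<Suc n}) \<longlonglongrightarrow> suminf c - suminf c"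
      by (intro tendsto_diff tendsto_const LIMSEQ_Suc summable_LIMSEQ c)
    then show ?thesis
      by (simp only: D_def[abs_def] suminf_minus_initial_segment[OF c] diff_self)
  qed
  have c_Suc: "c (Suc n) = D n - D (Suc n)" for n
    unfolding D_def suminf_minus_initial_segment[OF c] by simp
  have c_0: "c 0 = suminf c - D 0"
    unfolding D_def suminf_minus_initial_segment[OF c] by simp
  have D_bounded: "Bseq D"
    using D_lim by (intro convergent_imp_Bseq) (auto simp: convergent_def)
  then obtain K where K: "\<And>n. norm (D n) \<le> K"
    by (auto simp: Bseq_def)
  have D_summable: "summable (\<lambda>n. norm (r ^ n *\<^sub>R D n))" if "0 < r" "r < 1" for r :: real
  proof (rule summable_comparison_test')
    show "summable (\<lambda>n. r ^ n * K)"
      using that by (intro summable_mult2 summable_geometric) auto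
    show "norm (norm (r ^ n *\<^sub>R D n)) \<le> r ^ n * K" if "n \<ge> 0" for n
      using K \<open>0 < r\<close> by (simp add: mult_left_mono)
  qed
  \<comment> \<open>Shifting the index in \<open>c (Suc n) = D n - D (Suc n)\<close> leaves the
    factor \<open>1 - r\<close>; the boundary term \<open>D 0\<close> cancels against the one in
    \<open>c 0\<close>.\<close>
  have by_parts: "(\<Sum>n. r ^ n *\<^sub>R c n) = suminf c - (1 - r) *\<^sub>R (\<Sum>n. r ^ n *\<^sub>R D n)"
    if r: "0 < r" "r < 1" for r :: real
  proof -
    have s: "summable (\<lambda>n. r ^ n *\<^sub>R D n)"
      using D_summable[OF r] by (rule summable_norm_cancel)
    have s': "(\<lambda>n. r ^ Suc n *\<^sub>R D (Suc n)) sums ((\<Sum>n. r ^ n *\<^sub>R D n) - D 0)"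
      using s sums_Suc_iff[of "\<lambda>n. r ^ n *\<^sub>R D n"] by (simp add: summable_sums)
    have s'': "(\<lambda>n. r *\<^sub>R r ^ n *\<^sub>R D n) sums (r *\<^sub>R (\<Sum>n. r ^ n *\<^sub>R D n))"
      using s by (intro sums_scaleR_right summable_sums)
    have "(\<lambda>n. r ^ Suc n *\<^sub>R c (Suc n)) sums
        (r *\<^sub>R (\<Sum>n. r ^ n *\<^sub>R D n) - ((\<Sum>n. r ^ n *\<^sub>R D n) - D 0))"
      using sums_diff[OF s'' s'] by (simp add: c_Suc scaleR_diff_right)
    then have "(\<lambda>n. r ^ n *\<^sub>R c n) sums
        (r *\<^sub>R (\<Sum>n. r ^ n *\<^sub>R D n) - ((\<Sum>n. r ^ n *\<^sub>R D n) - D 0) + c 0)"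
      by (subst (asm) sums_Suc_iff) simp
    then show ?thesis
      by (simp add: sums_iff c_0 algebra_simps)
  qed
  have "((\<lambda>r. (1 - r) *\<^sub>R (\<Sum>n. r ^ n *\<^sub>R D n)) \<longlongrightarrow> 0) (at_left 1)"
  proof (rule tendstoI)
    fix e :: real assume e: "e > 0"
    obtain N where N: "\<And>n. n \<ge> N \<Longrightarrow> norm (D n) < e / 2"
      using LIMSEQ_D[OF D_lim, of "e / 2"] e by auto
    define M where "M = (\<Sum>n<N. norm (D n))"
    have "((\<lambda>r. (1 - r) * M) \<longlongrightarrow> (1 - 1) * M) (at_left 1)"
      by (intro tendsto_intros)
    then have "\<forall>\<^sub>F r in at_left 1. (1 - r) * M < e / 2"
      using e by (intro order_tendstoD(2)) auto
    moreover have "\<forall>\<^sub>F r in at_left (1::real). 0 < r \<and> r < 1"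
      using eventually_at_left_real[of 0 1] by simp
    ultimately show "\<forall>\<^sub>F r in at_left 1. dist ((1 - r) *\<^sub>R (\<Sum>n. r ^ n *\<^sub>R D n)) 0 < e"
    proof eventually_elim
      case (elim r)
      \<comment> \<open>Majorant: the terms below \<open>N\<close> contribute at most
        \<open>M\<close>, and those from \<open>N\<close> on are dominated by a geometric series.
        After multiplication by \<open>1 - r\<close> the geometric part is exactly
        \<open>e / 2\<close>, while \<open>(1 - r) * M < e / 2\<close> for \<open>r\<close> close to
        1.\<close>
      let ?b = "\<lambda>n. (if n \<in> {..<N} then norm (D n) else 0) + e / 2 * r ^ n"
      have "(\<lambda>n. r ^ n) sums (1 / (1 - r))"
        using elim by (intro geometric_sums) auto
      then have b: "?b sums (M + e / 2 * (1 / (1 - r)))"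
        unfolding M_def by (intro sums_add sums_mult sums_If_finite_set) auto
      have le: "norm (r ^ n *\<^sub>R D n) \<le> ?b n" for n
      proof (cases "n < N")
        case True
        have "r ^ n * norm (D n) \<le> 1 * norm (D n)"
          using elim by (intro mult_right_mono power_le_one) auto
        moreover have "0 \<le> e / 2 * r ^ n"
          using e elim by simp
        ultimately show ?thesis using True elim by simp
      next
        case False
        then have "r ^ n * norm (D n) \<le> r ^ n * (e / 2)"
          using elim N[of n] by (intro mult_left_mono) auto
        then show ?thesis using False elim by (simp add: mult.commute)
      qed
      have "norm (\<Sum>n. r ^ n *\<^sub>R D n) \<le> (\<Sum>n. norm (r ^ n *\<^sub>R D n))"
        using D_summable[of r] elim by (intro summable_norm) auto
      also have "\<dots> \<le> M + e / 2 * (1 / (1 - r))"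
        using D_summable[of r] elim le b
        by (intro sums_le[OF _ summable_sums b]) auto
      finally have "(1 - r) * norm (\<Sum>n. r ^ n *\<^sub>R D n) \<le> (1 - r) * (M + e / 2 * (1 / (1 - r)))"
        using elim by (intro mult_left_mono) auto
      also have "\<dots> = (1 - r) * M + e / 2"
        using elim by (simp add: field_simps)
      also have "\<dots> < e"
        using elim by simp
      finally show ?case
        using elim by simp
    qed
  qed
  then have "((\<lambda>r. suminf c - (1 - r) *\<^sub>R (\<Sum>n. r ^ n *\<^sub>R D n)) \<longlongrightarrow> suminf c - 0) (at_left 1)"
    by (intro tendsto_intros)
  moreover have "\<forall>\<^sub>F r in at_left 1.
      suminf c - (1 - r) *\<^sub>R (\<Sum>n. r ^ n *\<^sub>R D n) = (\<Sum>n. r ^ n *\<^sub>R c n)"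
    using eventually_at_left_real[of 0 1] by (auto elim!: eventually_mono simp: by_parts)
  ultimately show ?thesis
    by (auto elim: Lim_transform_eventually)
qed

section \<open>Sines of odd multiples as polynomials and as products\<close>

text \<open>Its value at y is the Chebyshev value U_2m(c) for c^2 = 1 - y. The recursion encodes
  sin(w + 2z) + sin(w - 2z) = 2 sin w cos 2z with y = sin^2 z, and \<open>[:2, -4:]\<close> is 2 cos
  2z = 2 - 4y.\<close>

fun sin_odd_poly :: "nat \<Rightarrow> complex poly" where
  "sin_odd_poly 0 = 1"
| "sin_odd_poly (Suc 0) = [:3, -4:]"
| "sin_odd_poly (Suc (Suc m)) = [:2, -4:] * sin_odd_poly (Suc m) - sin_odd_poly m"

lemma sin_odd_multiple:
  fixes z :: complex
  shows "sin (of_nat (2 * m + 1) * z) = poly (sin_odd_poly m) ((sin z)\<^sup>2) * sin z"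
proof (induction m rule: sin_odd_poly.induct)
  case 1
  show ?case by simp
next
  case 2
  have "sin (3 * z) = sin (2 * z + z)"
    by (simp add: algebra_simps)
  also have "\<dots> = 2 * sin z * (cos z)\<^sup>2 + (1 - 2 * (sin z)\<^sup>2) * sin z"
    unfolding sin_add sin_double cos_double_sin by (simp add: power2_eq_square)
  also have "\<dots> = (3 - 4 * (sin z)\<^sup>2) * sin z"
    by (simp add: cos_squared_eq algebra_simps)
  finally show ?case
    by (simp add: algebra_simps)
next
  case (3 m)
  define w where "w = of_nat (2 * Suc m + 1) * z"
  have "sin (w + 2 * z) + sin (w - 2 * z) = 2 * sin w * cos (2 * z)"
    by (simp add: sin_add sin_diff)
  moreover have "w + 2 * z = of_nat (2 * Suc (Suc m) + 1) * z" "w - 2 * z = of_nat (2 * m + 1) * z"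
    by (simp_all add: w_def algebra_simps)
  ultimately have "sin (of_nat (2 * Suc (Suc m) + 1) * z) =
      2 * sin w * (1 - 2 * (sin z)\<^sup>2) - sin (of_nat (2 * m + 1) * z)"
    by (simp only: cos_double_sin) (simp add: algebra_simps)
  then show ?case
    unfolding w_def 3 by (simp add: algebra_simps)
qed

lemma degree_sin_odd_poly: "degree (sin_odd_poly m) \<le> m"
proof (induction m rule: sin_odd_poly.induct)
  case (3 m)
  have "degree ([:2, -4:] * sin_odd_poly (Suc m)) \<le> 1 + Suc m"
    using 3(1) by (intro order.trans[OF degree_mult_le] add_mono) auto
  then show ?case
    using 3(2) by (auto intro!: degree_diff_le)
qed auto

lemma poly_sin_odd_poly_0: "poly (sin_odd_poly m) 0 = of_nat (2 * m + 1)"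
  by (induction m rule: sin_odd_poly.induct) (simp_all add: algebra_simps)

text \<open>With the common factor sin z split off, both sides are polynomials in y = sin^2 z of
  degree at most m. They agree at the m + 1 points 0 and \<open>s k\<close>, hence as polynomials,
  which also covers sin z = 0.\<close>

theorem sin_odd_multiple_prod:
  fixes z :: complex
  shows "sin (of_nat (2 * m + 1) * z) = of_nat (2 * m + 1) * sin z *
    (\<Prod>k = 1..m. 1 - (sin z)\<^sup>2 / of_real ((sin (of_nat k * pi / of_nat (2 * m + 1)))\<^sup>2))"
proof -
  define t :: "nat \<Rightarrow> real" where "t k = of_nat k * pi / of_nat (2 * m + 1)" for k
  define s :: "nat \<Rightarrow> complex" where "s k = of_real ((sin (t k))\<^sup>2)" for k
  define Q where "Q = smult (of_nat (2 * m + 1)) (\<Prod>k = 1..m. [:1, - 1 / s k:])"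
  have poly_Q: "poly Q y = of_nat (2 * m + 1) * (\<Prod>k = 1..m. 1 - y / s k)" for y
    by (simp add: Q_def poly_prod)
  \<comment> \<open>On (0, pi/2) the sine is positive and injective, so the \<open>s k\<close> are
    nonzero and pairwise distinct.\<close>
  have t: "0 < t k" "t k < pi / 2" if "k \<in> {1..m}" for k
  proof -
    have "2 * real k < 2 * real m + 1"
      using that by simp
    then have "pi * (2 * real k) < pi * (2 * real m + 1)"
      by (intro mult_strict_left_mono) auto
    then show "t k < pi / 2"
      by (simp add: t_def field_simps)
    show "0 < t k"
      using that by (simp add: t_def)
  qed
  have sin_pos: "sin (t k) > 0" if "k \<in> {1..m}" for k
    using t[OF that] by (intro sin_gt_zero) auto
  have s_nz: "s k \<noteq> 0" if "k \<in> {1..m}" for k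
    using sin_pos[OF that] by (simp add: s_def)
  have inj: "inj_on s {1..m}"
  proof (rule inj_onI)
    fix j k assume jk: "j \<in> {1..m}" "k \<in> {1..m}" and "s j = s k"
    then have "(sin (t j))\<^sup>2 = (sin (t k))\<^sup>2"
      by (simp only: s_def of_real_eq_iff)
    then have "sin (t j) = sin (t k)"
      using sin_pos[OF jk(1)] sin_pos[OF jk(2)] by (simp add: power2_eq_iff_nonneg)
    then have "t j = t k"
      using t[OF jk(1)] t[OF jk(2)] by - (rule sin_inj_pi; simp)
    then show "j = k"
      by (simp add: t_def del: of_nat_add of_nat_mult of_nat_Suc)
  qed
  have "sin_odd_poly m = Q"
  proof (rule poly_eqI_degree)
    have card: "card (insert 0 (s ` {1..m})) = Suc m"
      using s_nz card_image[OF inj] by (subst card_insert_disjoint) auto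
    show "degree (sin_odd_poly m) < card (insert 0 (s ` {1..m}))"
      unfolding card using degree_sin_odd_poly[of m] by simp
    have "degree (\<Prod>k = 1..m. [:1, - 1 / s k:]) \<le> (\<Sum>k = 1..m. degree [:1, - 1 / s k:])"
      using degree_prod_sum_le[of "{1..m}" "\<lambda>k. [:1, - 1 / s k:]"] by (simp add: o_def)
    also have "\<dots> \<le> (\<Sum>k = 1..m. 1)"
      by (intro sum_mono) simp
    finally show "degree Q < card (insert 0 (s ` {1..m}))"
      unfolding card Q_def by simp
  next
    fix y assume "y \<in> insert 0 (s ` {1..m})"
    then consider "y = 0" | k where "k \<in> {1..m}" "y = s k"
      by auto
    then show "poly (sin_odd_poly m) y = poly Q y"
    proof cases
      case 1
      then show ?thesis by (simp add: poly_sin_odd_poly_0 poly_Q)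
    next
      case 2
      \<comment> \<open>At z = \<open>t k\<close> the odd multiple is k pi, where the sine vanishes;
        as sin(\<open>t k\<close>) is nonzero, the polynomial factor must vanish.\<close>
      have "of_nat (2 * m + 1) * complex_of_real (t k) = of_real (of_nat k * pi)"
        unfolding t_def by (simp del: of_nat_Suc)
      then have "sin (of_nat (2 * m + 1) * complex_of_real (t k)) = of_real (sin (of_nat k * pi))"
        by (simp only: sin_of_real)
      then have "poly (sin_odd_poly m) ((sin (complex_of_real (t k)))\<^sup>2) *
          sin (complex_of_real (t k)) = 0"
        unfolding sin_odd_multiple by (simp add: sin_npi)
      then have "poly (sin_odd_poly m) y = 0"
        using sin_pos[OF 2(1)] by (simp add: 2(2) s_def sin_of_real)
      moreover have "(\<Prod>k = 1..m. 1 - y / s k) = 0"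
        using 2 s_nz[OF 2(1)] by (intro prod_zero) auto
      ultimately show ?thesis by (simp add: poly_Q)
    qed
  qed
  then show ?thesis
    unfolding sin_odd_multiple by (simp add: poly_Q s_def t_def)
qed

section \<open>Closed forms inside the disc of convergence\<close>

lemma degenerate_exp_eq_powr:
  assumes "l \<noteq> 0" "norm (of_real l * t) < 1"
  shows "degenerate_exp l x t = (1 + of_real l * t) powr (x / of_real l)"
  using gen_binomial_complex[OF assms(2), of "x / of_real l"]
  by (simp add: degenerate_exp_def degenerate_exp_term_eq_gbinomial[OF assms(1)] sums_iff)

text \<open>Since 1 + la is nonzero, the powers are exponentials of multiples of its principal
  logarithm. The factor of \<open>x\<close> is independent of \<open>x\<close>, so multiplying
  \<open>x\<close> by 2m + 1 multiplies the argument of the sine by 2m + 1.\<close>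

lemma degenerate_sin_eq_sin:
  assumes "l \<noteq> 0" "norm (of_real l * a) < 1"
  shows "degenerate_sin l x a = sin (x * (Ln (1 + of_real l * a) / of_real l))"
proof -
  have "1 + of_real l * a \<noteq> 0"
    using assms(2) by (metis add_eq_0_iff norm_minus_cancel norm_one less_irrefl)
  then show ?thesis
    by (simp add: degenerate_sin_def degenerate_exp_eq_powr[OF assms] powr_def sin_exp_eq mult_ac)
qed

section \<open>Radial limits and divergence outside the disc\<close>

text \<open>Scaling \<open>t\<close> by \<open>r\<close> multiplies the n-th term by
  \<open>r ^ n\<close>, which is the form of Abel's theorem.\<close>

lemma degenerate_exp_radial_limit:
  assumes "summable (degenerate_exp_term l x t)"
  shows "((\<lambda>r. degenerate_exp l x (of_real r * t)) \<longlongrightarrow> degenerate_exp l x t) (at_left 1)"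
proof -
  have "degenerate_exp_term l x (of_real r * t) n = r ^ n *\<^sub>R degenerate_exp_term l x t n" for r n
    by (simp add: degenerate_exp_term_def scaleR_conv_of_real power_mult_distrib)
  then show ?thesis
    using Abel_limit[OF assms] by (simp add: degenerate_exp_def)
qed

lemma degenerate_sin_radial_limit:
  assumes "degenerate_sin_converges l x a"
  shows "((\<lambda>r. degenerate_sin l x (of_real r * a)) \<longlongrightarrow> degenerate_sin l x a) (at_left 1)"
  using assms unfolding degenerate_sin_def degenerate_sin_converges_def
  by (auto intro!: tendsto_intros degenerate_exp_radial_limit)

text \<open>Unless the exponent is a natural number, the binomial series in \<open>l * t\<close> has
  radius of convergence 1.\<close>

lemma Nats_if_summable_degenerate_exp_term:
  assumes "l \<noteq> 0" "norm (of_real l * t) > 1" "summable (degenerate_exp_term l x t)"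
  shows "x / of_real l \<in> \<nat>"
proof (rule ccontr)
  assume "x / of_real l \<notin> \<nat>"
  then have "conv_radius (\<lambda>n. (x / of_real l) gchoose n) = 1"
    by (simp add: conv_radius_gchoose)
  moreover have "summable (\<lambda>n. ((x / of_real l) gchoose n) * (of_real l * t) ^ n)"
    using assms(3) by (simp add: degenerate_exp_term_eq_gbinomial[OF assms(1), abs_def])
  ultimately have "ereal (norm (of_real l * t)) \<le> 1"
    using conv_radius_geI by fastforce
  with assms(2) show False
    by (simp add: one_ereal_def)
qed

text \<open>The two exponents are natural numbers with sum 0, so both are 0.\<close>

lemma degenerate_sin_converges_outside:
  assumes "l \<noteq> 0" "norm (of_real l * a) > 1" "degenerate_sin_converges l x a"
  shows "x = 0"
proof -
  have "x * \<i> / of_real l \<in> \<nat>" "- (x * \<i>) / of_real l \<in> \<nat>"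
    using assms(3) Nats_if_summable_degenerate_exp_term[OF assms(1,2)]
    unfolding degenerate_sin_converges_def by blast+
  then obtain p q :: nat where p: "x * \<i> / of_real l = of_nat p" and q: "- (x * \<i>) / of_real l = of_nat q"
    by (auto elim!: Nats_cases)
  then have "of_nat p + of_nat q = (0 :: complex)"
    by (simp flip: p q)
  then have "p = 0"
    by (simp flip: of_nat_add)
  then show ?thesis
    using p assms(1) by simp
qed

theorem theorem2p5:
  fixes l :: real and x a :: complex and m :: nat
  assumes "l \<noteq> 0"
    and "degenerate_sin_converges l x a"
    and "degenerate_sin_converges l (of_nat (2 * m + 1) * x) a"
  shows "degenerate_sin l (of_nat (2 * m + 1) * x) a =
           of_nat (2 * m + 1) * degenerate_sin l x a *
             (\<Prod>k = 1..m. 1 - (degenerate_sin l x a)\<^sup>2 /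
                of_real ((sin (of_nat k * pi / of_nat (2 * m + 1)))\<^sup>2))"
proof (cases "norm (of_real l * a) > 1")
  case True
  \<comment> \<open>For \<open>x = 0\<close> the two exponentials in each sine coincide, and both
    sides are 0.\<close>
  then have "x = 0"
    using assms degenerate_sin_converges_outside by blast
  then show ?thesis
    by (simp add: degenerate_sin_def)
next
  case False
  \<comment> \<open>\<open>F\<close> is the right-hand side as a function of the sine. For 0 < r < 1
    the point \<open>r * a\<close> lies inside the disc, where the closed form applies; continuity
    of \<open>F\<close> then carries the identity to r = 1.\<close>
  define F where "F s = of_nat (2 * m + 1) * s *
    (\<Prod>k = 1..m. 1 - s\<^sup>2 / of_real ((sin (of_nat k * pi / of_nat (2 * m + 1)))\<^sup>2))" for s :: complex
  have "degenerate_sin l (of_nat (2 * m + 1) * x) (of_real r * a) =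
      F (degenerate_sin l x (of_real r * a))" if r: "0 < r" "r < 1" for r
  proof -
    have "norm (of_real l * (of_real r * a)) = r * norm (of_real l * a)"
      using r by (simp add: norm_mult)
    also have "\<dots> \<le> r * 1"
      using False r by (intro mult_left_mono) auto
    finally have "norm (of_real l * (of_real r * a)) < 1"
      using r by simp
    note sin = degenerate_sin_eq_sin[OF assms(1) this]
    show ?thesis
      \<comment> \<open>Reassociation exposes the argument as 2m + 1 times the argument of the sine
        for \<open>x\<close>.\<close>
      unfolding sin F_def mult.assoc[of _ x] sin_odd_multiple_prod ..
  qed
  then have "\<forall>\<^sub>F r in at_left 1. F (degenerate_sin l x (of_real r * a)) =
      degenerate_sin l (of_nat (2 * m + 1) * x) (of_real r * a)"
    using eventually_at_left_real[of 0 1] by (auto elim!: eventually_mono)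
  moreover have "isCont F (degenerate_sin l x a)"
    unfolding F_def divide_inverse by (intro continuous_intros)
  then have "((\<lambda>r. F (degenerate_sin l x (of_real r * a))) \<longlongrightarrow> F (degenerate_sin l x a)) (at_left 1)"
    by (rule isCont_tendsto_compose[OF _ degenerate_sin_radial_limit[OF assms(2)]])
  ultimately have "((\<lambda>r. degenerate_sin l (of_nat (2 * m + 1) * x) (of_real r * a)) \<longlongrightarrow>
      F (degenerate_sin l x a)) (at_left 1)"
    by (rule Lim_transform_eventually[rotated])
  from tendsto_unique[OF _ degenerate_sin_radial_limit[OF assms(3)] this]
  show ?thesis
    by (simp add: F_def)
qed

end
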